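(* Let $X$ and $Y$ be connected graphs all of whose vertex degrees are at most $d<\infty$, and suppose that for some $\kappa<\infty$ there is a $\kappa$-regular map $f$ from $X$ to $Y$. Then $sep_X(x)=O(sep_Y(x))$; that is, there is a constant $C<\infty$ such that $sep_X(x)\le C\, sep_Y(x)$ for every $x$.
   Context: Graphs are regarded as metric spaces on their vertex sets, with the graph distance. Regular maps: let $(X,d_X),(Y,d_Y)$ be metric spaces and $\kappa<\infty$. A (not necessarily continuous) map $f:X\to Y$ is $\kappa$-regular if (1) $d_Y(f(x_0),f(x_1))\le \kappa(1+d_X(x_0,x_1))$ for every $x_0,x_1\in X$, and (2) for every open ball $B=B(y_0,1)$ of radius $1$ in $Y$, the inverse image $f^{-1}(B)$ can be covered by $\kappa$ open balls of radius $1$ in $X$. (For graphs, open balls of radius 1 are single vertices, so (2) says that each vertex of $Y$ has at most $\kappa$ preimages.) Separation: for a finite set $S$ of vertices of a graph $G$, $cut(S)$ is the minimum size of a subset $C_S\subset S$ such that the largest connected component of the subgraph of $G$ induced by $S\setminus C_S$ has fewer than $|S|/2$ vertices. The separation function is $sep_G(x)=\sup\{cut(S): S\subset V(G),\ |S|\le x\}$ (supremum of the empty set being $0$). *)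

theory Defs
  imports "HOL-Analysis.Abstract_Metric_Spaces"
begin

text \<open>A simple graph, finite or infinite, is a vertex set \<open>V\<close> with a symmetric irreflexive
  adjacency relation \<open>E\<close> on it.\<close>

definition simple_graph :: "'a set \<Rightarrow> 'a rel \<Rightarrow> bool" where
  "simple_graph V E \<longleftrightarrow> E \<subseteq> V \<times> V \<and> sym E \<and> irrefl E"

definition connected_graph :: "'a set \<Rightarrow> 'a rel \<Rightarrow> bool" where
  "connected_graph V E \<longleftrightarrow> simple_graph V E \<and> (\<forall>u\<in>V. \<forall>v\<in>V. (u, v) \<in> E\<^sup>*)"

text \<open>Finiteness is required separately because \<^const>\<open>card\<close> is 0 on infinite sets.\<close>

definition degrees_at_most :: "'a set \<Rightarrow> 'a rel \<Rightarrow> nat \<Rightarrow> bool" where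
  "degrees_at_most V E d \<longleftrightarrow> (\<forall>v\<in>V. finite (E `` {v}) \<and> card (E `` {v}) \<le> d)"

text \<open>The length of a shortest path; only meaningful for vertices joined by a path.\<close>

definition graph_dist :: "'a rel \<Rightarrow> 'a \<Rightarrow> 'a \<Rightarrow> real" where
  "graph_dist E u v = real (LEAST n. (u, v) \<in> E ^^ n)"

lemma Metric_space_graph_dist:
  assumes "connected_graph V E"
  shows "Metric_space V (graph_dist E)"
proof
  have symE: "sym E" using assms by (simp add: connected_graph_def simple_graph_def)
  have sym_pow: "(y, x) \<in> E ^^ n" if "(x, y) \<in> E ^^ n" for x y n
    using that
  proof (induction n arbitrary: y)
    case (Suc n)
    then obtain z where "(x, z) \<in> E ^^ n" "(z, y) \<in> E" by auto
    then have "(z, x) \<in> E ^^ n" "(y, z) \<in> E" using Suc.IH symE by (auto dest: symD)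
    then show ?case by (rule relpow_Suc_I2[rotated])
  qed simp
  have walk: "(x, y) \<in> E ^^ (LEAST n. (x, y) \<in> E ^^ n)" if "x \<in> V" "y \<in> V" for x y
  proof -
    have "\<exists>n. (x, y) \<in> E ^^ n"
      using that assms by (auto simp: connected_graph_def dest: rtrancl_imp_relpow)
    then show ?thesis by (rule LeastI_ex)
  qed
  show "0 \<le> graph_dist E x y" for x y by (simp add: graph_dist_def)
  show "graph_dist E x y = graph_dist E y x" for x y
  proof -
    have "(x, y) \<in> E ^^ n \<longleftrightarrow> (y, x) \<in> E ^^ n" for n using sym_pow by blast
    then show ?thesis by (simp add: graph_dist_def)
  qed
  show "graph_dist E x y = 0 \<longleftrightarrow> x = y" if "x \<in> V" "y \<in> V" for x y
  proof
    assume "graph_dist E x y = 0"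
    then have "(LEAST n. (x, y) \<in> E ^^ n) = 0" by (simp add: graph_dist_def)
    with walk[OF that] have "(x, y) \<in> E ^^ 0" by simp
    then show "x = y" by simp
  next
    assume "x = y"
    then have "(x, y) \<in> E ^^ 0" by simp
    then show "graph_dist E x y = 0" unfolding graph_dist_def by (metis Least_eq_0 of_nat_0)
  qed
  show "graph_dist E x z \<le> graph_dist E x y + graph_dist E y z"
    if "x \<in> V" "y \<in> V" "z \<in> V" for x y z
  proof -
    have "(x, z) \<in> E ^^ ((LEAST n. (x, y) \<in> E ^^ n) + (LEAST n. (y, z) \<in> E ^^ n))"
      using walk that by (auto simp: relpow_add)
    then have "(LEAST n. (x, z) \<in> E ^^ n)
        \<le> (LEAST n. (x, y) \<in> E ^^ n) + (LEAST n. (y, z) \<in> E ^^ n)"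
      by (rule Least_le)
    then show ?thesis by (simp add: graph_dist_def)
  qed
qed

text \<open>\<open>\<kappa>\<close>-regular maps between metric spaces \<open>(X, dX)\<close> and \<open>(Y, dY)\<close>. As \<open>\<kappa>\<close> is real, being
  covered by \<open>\<kappa>\<close> balls means being covered by at most \<open>\<kappa>\<close> balls.\<close>

definition regular_map ::
    "real \<Rightarrow> 'a set \<Rightarrow> ('a \<Rightarrow> 'a \<Rightarrow> real) \<Rightarrow> 'b set \<Rightarrow> ('b \<Rightarrow> 'b \<Rightarrow> real) \<Rightarrow> ('a \<Rightarrow> 'b) \<Rightarrow> bool" where
  "regular_map \<kappa> X dX Y dY f \<longleftrightarrow>
     f \<in> X \<rightarrow> Y \<and>
     (\<forall>x0\<in>X. \<forall>x1\<in>X. dY (f x0) (f x1) \<le> \<kappa> * (1 + dX x0 x1)) \<and>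
     (\<forall>y0\<in>Y. \<exists>T\<subseteq>X. finite T \<and> real (card T) \<le> \<kappa> \<and>
        {x \<in> X. f x \<in> Metric_space.mball Y dY y0 1} \<subseteq> (\<Union>t\<in>T. Metric_space.mball X dX t 1))"

definition induced_edges :: "'a rel \<Rightarrow> 'a set \<Rightarrow> 'a rel" where
  "induced_edges E W = E \<inter> (W \<times> W)"

definition graph_components :: "'a set \<Rightarrow> 'a rel \<Rightarrow> 'a set set" where
  "graph_components V E = V // E\<^sup>*"

text \<open>For a graph without vertices this is the supremum of the empty set of naturals, i.e. 0.\<close>

definition largest_component_size :: "'a set \<Rightarrow> 'a rel \<Rightarrow> nat" where
  "largest_component_size V E = (SUP K \<in> graph_components V E. card K)"

text \<open>Taking \<open>C = S\<close> shows that the infimum is over a nonempty set, hence a minimum, whenever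
  \<open>S\<close> is finite and nonempty.\<close>

definition cut :: "'a rel \<Rightarrow> 'a set \<Rightarrow> nat" where
  "cut E S = Inf {card C | C. C \<subseteq> S \<and>
     real (largest_component_size (S - C) (induced_edges E (S - C))) < real (card S) / 2}"

text \<open>No set qualifies as \<open>C\<close> for \<open>S = {}\<close>, so \<open>S\<close> ranges over nonempty sets. The values are
  bounded by \<open>x\<close>, so the supremum is a proper one; for \<open>x < 1\<close> it is \<open>Sup {} = 0\<close>.\<close>

definition sep :: "'a set \<Rightarrow> 'a rel \<Rightarrow> real \<Rightarrow> nat" where
  "sep V E x = Sup {cut E S | S. S \<subseteq> V \<and> finite S \<and> S \<noteq> {} \<and> real (card S) \<le> x}"

end

theory Submission
  imports Defs
begin

text \<open>Given a finite \<open>S \<subseteq> X\<close>, separate the neighbourhood of radius about \<open>2\<kappa>\<close> of \<open>f(S)\<close> in \<open>Y\<close>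
  into small pieces and pull the separator back. This compares \<open>sep_X(x)\<close> with \<open>sep_Y(Kx)\<close> for a
  constant \<open>K\<close>, so one needs \<open>sep_Y(Kx) = O(sep_Y(x))\<close>. For that, let \<open>W\<close> have \<open>N\<close> vertices and
  suppose that all sets of at most \<open>0.9 N\<close> vertices are separated by \<open>s\<close> vertices. Among the
  \<open>Z \<subseteq> W\<close> of size between \<open>a\<close> and \<open>2a\<close>, where \<open>a \<approx> N/10\<close>, take one whose edge boundary \<open>b\<close> is
  smallest. Breaking \<open>W - Z\<close> by a set \<open>R\<close> of \<open>O(s)\<close> vertices and regrouping the pieces yields two
  sets of size between \<open>a\<close> and \<open>2a\<close> all of whose boundary edges go to \<open>Z\<close> or to \<open>R\<close>. By minimality
  \<open>2b \<le> b + d|R|\<close>, so \<open>b = O(s)\<close>, and \<open>R\<close> with the inner boundary of \<open>Z\<close> separates \<open>W\<close>.\<close>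

section \<open>Components and cuts\<close>

definition component :: "'a rel \<Rightarrow> 'a set \<Rightarrow> 'a \<Rightarrow> 'a set" where
  "component E W v = (induced_edges E W)\<^sup>* `` {v}"

lemma component_self [simp]: "v \<in> component E W v"
  by (simp add: component_def)

lemma component_subset: "v \<in> W \<Longrightarrow> component E W v \<subseteq> W"
proof
  fix x assume v: "v \<in> W" and "x \<in> component E W v"
  then have "(v, x) \<in> (induced_edges E W)\<^sup>*" by (simp add: component_def)
  then show "x \<in> W" by (induction) (use v in \<open>auto simp: induced_edges_def\<close>)
qed

lemma component_mono: "W \<subseteq> W' \<Longrightarrow> component E W v \<subseteq> component E W' v"
  unfolding component_def induced_edges_def by (intro Image_mono rtrancl_mono) auto

lemma component_step:
  assumes "x \<in> component E W v" "(x, y) \<in> E" "x \<in> W" "y \<in> W"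
  shows "y \<in> component E W v"
  using assms unfolding component_def induced_edges_def
  by (auto intro: rtrancl_into_rtrancl)

text \<open>A walk in \<open>W\<close> that starts in \<open>D\<close> never leaves
  \<open>D\<close>, so it is also a walk in \<open>W \<inter> D\<close>. Components are confined to
  pieces by this lemma.\<close>

lemma component_subset_closed:
  assumes "v \<in> D" "\<And>x y. x \<in> D \<Longrightarrow> x \<in> W \<Longrightarrow> y \<in> W \<Longrightarrow> (x, y) \<in> E \<Longrightarrow> y \<in> D"
  shows "component E W v \<subseteq> component E (W \<inter> D) v \<inter> D"
proof
  fix x assume "x \<in> component E W v"
  then have "(v, x) \<in> (induced_edges E W)\<^sup>*" by (simp add: component_def)
  then show "x \<in> component E (W \<inter> D) v \<inter> D"
  proof induction
    case base then show ?case using assms(1) by simp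
  next
    case (step y z)
    then have "y \<in> W" "z \<in> W" "(y, z) \<in> E" by (auto simp: induced_edges_def)
    moreover from this step.IH assms(2) have "z \<in> D" by blast
    ultimately show ?case using step.IH component_step by (metis IntD1 IntD2 IntI)
  qed
qed

lemma sym_induced_edges: "sym E \<Longrightarrow> sym (induced_edges E W)"
  by (auto simp: sym_def induced_edges_def)

lemma component_eq:
  assumes "sym E" "x \<in> component E W v"
  shows "component E W x = component E W v"
proof -
  have "sym ((induced_edges E W)\<^sup>*)" using assms(1) by (intro sym_rtrancl sym_induced_edges)
  with assms(2) have "(v, x) \<in> (induced_edges E W)\<^sup>*" "(x, v) \<in> (induced_edges E W)\<^sup>*"
    by (auto simp: component_def dest: symD)
  then show ?thesis by (auto simp: component_def intro: rtrancl_trans)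
qed

section \<open>Cuts in terms of component sizes\<close>

lemma graph_components_eq: "graph_components W (induced_edges E W) = component E W ` W"
  by (auto simp: graph_components_def quotient_def component_def)

text \<open>Positivity of \<open>t\<close> covers the case \<open>W = {}\<close>, where the largest
  size is the supremum 0 of the empty set.\<close>

lemma largest_component_size_less_iff:
  assumes "finite W" "t > 0"
  shows "real (largest_component_size W (induced_edges E W)) < t \<longleftrightarrow>
    (\<forall>v\<in>W. real (card (component E W v)) < t)"
proof (cases "W = {}")
  case True
  then show ?thesis using assms
    by (simp add: largest_component_size_def graph_components_eq Sup_nat_def)
next
  case False
  let ?M = "(\<lambda>v. card (component E W v)) ` W"
  have M: "largest_component_size W (induced_edges E W) = Max ?M"
    using False by (simp add: largest_component_size_def graph_components_eq Sup_nat_def image_image)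
  have "Max ?M \<in> ?M" using assms False by (intro Max_in) auto
  moreover have "\<forall>m\<in>?M. m \<le> Max ?M" using assms by auto
  ultimately show ?thesis unfolding M
    by (smt (verit) image_iff of_nat_le_iff)
qed

lemma cut_le:
  assumes "finite S" "S \<noteq> {}" "C \<subseteq> S"
    and "\<And>v. v \<in> S - C \<Longrightarrow> 2 * card (component E (S - C) v) < card S"
  shows "cut E S \<le> card C"
proof -
  have "real (largest_component_size (S - C) (induced_edges E (S - C))) < real (card S) / 2"
    using assms by (subst largest_component_size_less_iff) (auto simp: card_gt_0_iff, fastforce)
  then show ?thesis unfolding cut_def using assms(3) by (intro cInf_lower) auto
qed

lemma obtain_cut:
  assumes "finite S" "S \<noteq> {}"
  obtains C where "C \<subseteq> S" "card C = cut E S"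
    "\<And>v. v \<in> S - C \<Longrightarrow> 2 * card (component E (S - C) v) < card S"
proof -
  let ?P = "\<lambda>C. C \<subseteq> S \<and>
     real (largest_component_size (S - C) (induced_edges E (S - C))) < real (card S) / 2"
  have pos: "real (card S) / 2 > 0" using assms by (simp add: card_gt_0_iff)
  have "?P S" using largest_component_size_less_iff[of "{}" "real (card S) / 2" E] pos by simp
  then have "{card C | C. ?P C} \<noteq> {}" by blast
  then have "cut E S \<in> {card C | C. ?P C}" unfolding cut_def by (rule Inf_nat_def1)
  then obtain C where C: "?P C" "card C = cut E S" by auto
  have "2 * card (component E (S - C) v) < card S" if "v \<in> S - C" for v
  proof -
    have "real (card (component E (S - C) v)) < real (card S) / 2"
      using C(1) largest_component_size_less_iff[of "S - C" "real (card S) / 2" E] pos assms that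
      by auto
    then show ?thesis by linarith
  qed
  with C that show ?thesis by blast
qed

lemma cut_le_card: "finite S \<Longrightarrow> S \<noteq> {} \<Longrightarrow> cut E S \<le> card S"
  by (rule cut_le) auto

text \<open>With nothing removed, a single vertex is a component of size 1, which is not below 1/2.
  The resulting lower bound on the separation function later absorbs additive constants.\<close>

lemma cut_pos: assumes "finite S" "S \<noteq> {}" "card S \<le> 1" shows "cut E S \<ge> 1"
proof (rule ccontr)
  assume "\<not> ?thesis"
  moreover obtain C where C: "C \<subseteq> S" "card C = cut E S"
    "\<And>v. v \<in> S - C \<Longrightarrow> 2 * card (component E (S - C) v) < card S"
    using obtain_cut assms by metis
  ultimately have "card C = 0" by linarith
  then have "C = {}" using C(1) assms(1) by (metis card_0_eq finite_subset)
  obtain v where v: "v \<in> S" using assms(2) by blast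
  with C(3) \<open>C = {}\<close> assms(3) have "card (component E S v) = 0" by fastforce
  moreover have "finite (component E S v)" using component_subset[OF v] assms(1) finite_subset by metis
  ultimately show False using component_self[of v E S] by auto
qed

section \<open>Breaking a set into small pieces\<close>

text \<open>Repeated halving: in the step from \<open>j\<close> to \<open>Suc j\<close> the
  components that are still too large are disjoint, so there are at most \<open>2 ^ Suc j\<close> of
  them, and \<open>s\<close> vertices break each into pieces of less than half its size. The costs
  of the steps add up like a geometric series.\<close>

lemma fragment:
  assumes "finite W" "sym E" "\<And>W'. W' \<subseteq> W \<Longrightarrow> W' \<noteq> {} \<Longrightarrow> cut E W' \<le> s"
  shows "\<exists>R\<subseteq>W. card R \<le> 2 ^ Suc j * s \<and>
    (\<forall>v\<in>W - R. card (component E (W - R) v) * 2 ^ j \<le> card W)"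
proof (induction j)
  case 0
  show ?case using assms(1)
    by (intro exI[of _ "{}"]) (auto intro!: card_mono component_subset)
next
  case (Suc j)
  then obtain R where R: "R \<subseteq> W" "card R \<le> 2 ^ Suc j * s"
    and small: "\<And>v. v \<in> W - R \<Longrightarrow> card (component E (W - R) v) * 2 ^ j \<le> card W" by blast
  \<comment> \<open>Only the components that violate the bound for \<open>Suc j\<close> are cut
    further.\<close>
  define big where "big = {K \<in> component E (W - R) ` (W - R). card W < card K * 2 ^ Suc j}"
  have big: "K \<subseteq> W - R" "K \<noteq> {}" "finite K" if K: "K \<in> big" for K
  proof -
    from K obtain v where v: "v \<in> W - R" "K = component E (W - R) v" by (auto simp: big_def)
    with component_subset[of v "W - R" E] show "K \<subseteq> W - R" by simp
    then show "finite K" using assms(1) by (auto intro: finite_subset)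
    show "K \<noteq> {}" using v component_self by fastforce
  qed
  have fbig: "finite big" using assms(1) by (simp add: big_def)
  have disj: "disjoint big"
  proof (rule disjointI)
    fix K L assume KL: "K \<in> big" "L \<in> big" "K \<noteq> L"
    then obtain u v where uv: "K = component E (W - R) u" "L = component E (W - R) v"
      by (auto simp: big_def)
    show "K \<inter> L = {}" using KL(3) component_eq[OF assms(2)] unfolding uv by blast
  qed
  have "card big \<le> 2 ^ Suc j"
  proof (cases "W = {}")
    case True then show ?thesis by (simp add: big_def)
  next
    case False
    have "card big * card W = (\<Sum>K\<in>big. card W)" by simp
    also have "\<dots> \<le> (\<Sum>K\<in>big. card K * 2 ^ Suc j)"
      by (intro sum_mono) (auto simp: big_def)
    also have "\<dots> = card (\<Union>big) * 2 ^ Suc j"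
      using disj big(3) by (simp add: card_Union_disjoint sum_distrib_right del: power_Suc)
    also have "card (\<Union>big) \<le> card W" using big(1) assms(1) by (intro card_mono) auto
    finally have "card big * card W \<le> 2 ^ Suc j * card W" by (simp add: mult.commute)
    then show ?thesis using False assms(1) by (simp add: card_gt_0_iff)
  qed
  have "\<exists>C\<subseteq>K. card C \<le> s \<and> (\<forall>v\<in>K - C. 2 * card (component E (K - C) v) < card K)"
    if K: "K \<in> big" for K
    using obtain_cut[OF big(3,2)[OF K], of E] assms(3)[of K] big(1,2)[OF K] by (metis Diff_subset subset_trans)
  then obtain C where C: "\<And>K. K \<in> big \<Longrightarrow> C K \<subseteq> K" "\<And>K. K \<in> big \<Longrightarrow> card (C K) \<le> s"
    "\<And>K v. K \<in> big \<Longrightarrow> v \<in> K - C K \<Longrightarrow> 2 * card (component E (K - C K) v) < card K"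
    by metis
  define R' where "R' = R \<union> (\<Union>K\<in>big. C K)"
  have "R' \<subseteq> W" using R(1) C(1) big(1) by (fastforce simp: R'_def)
  have "card R' \<le> card R + card (\<Union>K\<in>big. C K)" unfolding R'_def by (rule card_Un_le)
  also have "card (\<Union>K\<in>big. C K) \<le> (\<Sum>K\<in>big. card (C K))" using fbig by (rule card_UN_le)
  also have "\<dots> \<le> card big * s" using C(2) by (metis sum_bounded_above of_nat_id)
  also have "\<dots> \<le> 2 ^ Suc j * s" using \<open>card big \<le> 2 ^ Suc j\<close> by (rule mult_le_mono1)
  finally have R'card: "card R' \<le> 2 ^ Suc (Suc j) * s" using R(2) by simp
  have "card (component E (W - R') v) * 2 ^ Suc j \<le> card W" if v: "v \<in> W - R'" for v
  proof -
    let ?K = "component E (W - R) v"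
    have vR: "v \<in> W - R" using v by (simp add: R'_def)
    have K: "?K \<subseteq> W - R" by (rule component_subset[OF vR])
    then have fK: "finite ?K" using assms(1) by (auto intro: finite_subset)
    show ?thesis
    proof (cases "?K \<in> big")
      case False
      have "card (component E (W - R') v) \<le> card ?K"
        by (intro card_mono[OF fK] component_mono) (auto simp: R'_def)
      then have "card (component E (W - R') v) * 2 ^ Suc j \<le> card ?K * 2 ^ Suc j"
        by (rule mult_le_mono1)
      also have "\<dots> \<le> card W" using False vR by (auto simp: big_def)
      finally show ?thesis .
    next
      case True
      have vK: "v \<in> ?K - C ?K" using v True by (auto simp: R'_def)
      \<comment> \<open>Walks from \<open>v\<close> stay in the old component \<open>?K\<close> and,
        within it, avoid \<open>C ?K\<close>.\<close>
      have "component E (W - R') v \<subseteq> component E ((W - R') \<inter> ?K) v \<inter> ?K"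
        by (rule component_subset_closed) (auto simp: R'_def intro: component_step)
      also have "\<dots> \<subseteq> component E (?K - C ?K) v"
        by (rule subset_trans[OF Int_lower1 component_mono]) (use True in \<open>auto simp: R'_def\<close>)
      finally have "card (component E (W - R') v) \<le> card (component E (?K - C ?K) v)"
        using component_subset[OF vK, of E] fK by (auto intro!: card_mono intro: finite_subset)
      then have "2 * card (component E (W - R') v) \<le> card ?K"
        using C(3)[OF True vK] by linarith
      then have "2 * card (component E (W - R') v) * 2 ^ j \<le> card ?K * 2 ^ j"
        by (rule mult_le_mono1)
      also have "\<dots> \<le> card W" by (rule small[OF vR])
      finally show ?thesis by (simp add: mult_ac)
    qed
  qed
  then show ?case using \<open>R' \<subseteq> W\<close> R'card by blast
qed

section \<open>Enlarging the scale\<close>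

text \<open>The closed sets here are unions of components of \<open>U\<close>. A smallest one inside
  \<open>D\<close> with at least \<open>a\<close> vertices works: if it had more than
  \<open>2 * a\<close>, dropping one component, of at most \<open>a\<close> vertices, would give a
  smaller one.\<close>

lemma obtain_closed_subset_of_size:
  assumes "finite D" "sym E" "D \<subseteq> U" "E `` D \<inter> U \<subseteq> D" "a \<le> card D"
    and small: "\<And>v. v \<in> U \<Longrightarrow> card (component E U v) \<le> a"
  obtains D' where "D' \<subseteq> D" "E `` D' \<inter> U \<subseteq> D'" "a \<le> card D'" "card D' \<le> 2 * a"
proof -
  let ?P = "\<lambda>D'. D' \<subseteq> D \<and> E `` D' \<inter> U \<subseteq> D' \<and> a \<le> card D'"
  have "\<exists>D'. ?P D' \<and> (\<forall>D''. ?P D'' \<longrightarrow> card D' \<le> card D'')"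
    using ex_has_least_nat[of ?P D card] assms by blast
  then obtain D' where D': "?P D'" and least: "\<And>D''. ?P D'' \<Longrightarrow> card D' \<le> card D''" by blast
  have "card D' \<le> 2 * a"
  proof (rule ccontr)
    assume gt: "\<not> card D' \<le> 2 * a"
    then have "D' \<noteq> {}" by auto
    then obtain v where v: "v \<in> D'" by blast
    let ?K = "component E U v"
    have vU: "v \<in> U" using v D' assms(3) by blast
    have K: "?K \<subseteq> D'" using component_subset_closed[of v D' U E] v D' by blast
    have fD': "finite D'" using D' assms(1) finite_subset by blast
    have card: "card (D' - ?K) = card D' - card ?K"
      using K fD' by (meson card_Diff_subset finite_subset)
    have "E `` (D' - ?K) \<inter> U \<subseteq> D' - ?K"
    proof safe
      fix x y assume *: "x \<in> D'" "x \<notin> ?K" "(x, y) \<in> E" "y \<in> U"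
      then show "y \<in> D'" using D' by blast
      assume "y \<in> ?K"
      then have "x \<in> ?K" using * D' assms(2,3) by (meson component_step subsetD symD)
      with * show False by blast
    qed
    then have "card D' \<le> card (D' - ?K)"
      using D' card small[OF vU] gt by (intro least) auto
    moreover have "0 < card ?K" using K fD' component_self[of v E U]
      by (metis card_gt_0_iff empty_iff finite_subset)
    ultimately show False using card gt by linarith
  qed
  with D' that show ?thesis by blast
qed

lemma card_edges_le:
  assumes "finite R" "\<And>v. v \<in> R \<Longrightarrow> finite (E `` {v}) \<and> card (E `` {v}) \<le> d"
  shows "card (E \<inter> R \<times> W) \<le> d * card R"
proof -
  have "card (E \<inter> R \<times> W) \<le> card (Sigma R (\<lambda>v. E `` {v}))"
    using assms by (intro card_mono finite_SigmaI) auto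
  also have "\<dots> = (\<Sum>v\<in>R. card (E `` {v}))" using assms by (simp add: card_SigmaI)
  also have "\<dots> \<le> d * card R" 
    using sum_bounded_above[of R "\<lambda>v. card (E `` {v})" d] assms(2) by (simp add: mult.commute)
  finally show ?thesis .
qed

lemma card_edges_swap: "sym E \<Longrightarrow> card (E \<inter> A \<times> B) = card (E \<inter> B \<times> A)"
  by (rule bij_betw_same_card[of prod.swap], rule bij_betw_byWitness[of _ prod.swap])
    (auto dest: symD)

text \<open>The hypothesis \<open>cuts\<close> applies to subsets of \<open>W - Z\<close> because
  \<open>a \<le> card Z\<close>. As \<open>card W \<le> 32 * a\<close>, five halvings bring the
  pieces down to size at most \<open>a\<close>, at the cost of \<open>64 * s\<close> vertices. The
  bound \<open>10 * a \<le> card W\<close> keeps sets of size up to \<open>2 * a\<close> below half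
  of \<open>W\<close>.\<close>

lemma cut_enlarge:
  assumes W: "finite W" "W \<subseteq> V" and "sym E" and deg: "degrees_at_most V E d"
    and a: "0 < a" "10 * a \<le> card W" "card W \<le> 32 * a"
    and cuts: "\<And>W'. W' \<subseteq> W \<Longrightarrow> W' \<noteq> {} \<Longrightarrow> card W' + a \<le> card W \<Longrightarrow> cut E W' \<le> s"
  shows "cut E W \<le> 128 * (d + 1) * s"
proof -
  define bd where "bd Z = card (E \<inter> Z \<times> (W - Z))" for Z
  let ?P = "\<lambda>Z. Z \<subseteq> W \<and> a \<le> card Z \<and> card Z \<le> 2 * a"
  have "a \<le> card W" using a by linarith
  then obtain Z0 where "Z0 \<subseteq> W" "card Z0 = a" using obtain_subset_with_card_n by metis
  then have "?P Z0" by simp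
  then have "\<exists>Z. ?P Z \<and> (\<forall>Z'. ?P Z' \<longrightarrow> bd Z \<le> bd Z')"
    by (rule ex_has_least_nat)
  then obtain Z where Z: "Z \<subseteq> W" "a \<le> card Z" "card Z \<le> 2 * a"
    and least: "\<And>Z'. ?P Z' \<Longrightarrow> bd Z \<le> bd Z'" by blast
  have fZ: "finite Z" using Z(1) W(1) finite_subset by blast
  have cWZ: "card (W - Z) = card W - card Z" using fZ Z(1) by (simp add: card_Diff_subset)
  have "\<exists>R\<subseteq>W - Z. card R \<le> 2 ^ Suc 5 * s \<and>
    (\<forall>v\<in>W - Z - R. card (component E (W - Z - R) v) * 2 ^ 5 \<le> card (W - Z))"
  proof (rule fragment)
    fix W' assume "W' \<subseteq> W - Z" "W' \<noteq> {}"
    moreover from this have "card W' \<le> card (W - Z)" using W(1) by (simp add: card_mono)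
    ultimately show "cut E W' \<le> s" using cWZ Z a by (intro cuts) auto
  qed (use W assms in auto)
  then obtain R where R: "R \<subseteq> W - Z" "card R \<le> 64 * s"
    and frag: "\<And>v. v \<in> W - Z - R \<Longrightarrow> card (component E (W - Z - R) v) * 32 \<le> card (W - Z)"
    by auto
  let ?U = "W - Z - R"
  have small: "card (component E ?U v) \<le> a" if "v \<in> ?U" for v
    using frag[OF that] cWZ a by linarith
  have fR: "finite R" using R(1) W(1) finite_subset by blast
  have fU: "finite ?U" using W(1) by simp
  have Wne: "W \<noteq> {}" using a by auto
  have cU: "card ?U = card W - card Z - card R" using fR R(1) cWZ by (simp add: card_Diff_subset)
  show ?thesis
  proof (cases "5 * a + card R \<le> card W")
    \<comment> \<open>Here \<open>R\<close> is so large that all of \<open>W\<close> may be removed: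
      \<open>5 * a\<close> is at most half of \<open>card W\<close>, so
      \<open>card W \<le> 2 * card R\<close>. This case is the source of 128 in place of 64.\<close>
    case False
    have "cut E W \<le> card W" using W Wne by (simp add: cut_le_card)
    also have "\<dots> \<le> 2 * card R" using False a by linarith
    also have "\<dots> \<le> 128 * s" using R by linarith
    also have "\<dots> \<le> 128 * (d + 1) * s" by simp
    finally show ?thesis .
  next
    case True
    \<comment> \<open>Since \<open>card Z \<le> 2 * a\<close>, there is room for \<open>D1\<close>,
      of size at most \<open>2 * a\<close>, with at least \<open>a\<close> vertices left over for
      \<open>D2\<close>.\<close>
    then have "3 * a \<le> card ?U" using cU Z by linarith
    then have "a \<le> card ?U" by linarith
    then obtain D1 where D1: "D1 \<subseteq> ?U" "E `` D1 \<inter> ?U \<subseteq> D1" "a \<le> card D1" "card D1 \<le> 2 * a"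
      using obtain_closed_subset_of_size[OF fU \<open>sym E\<close> subset_refl, of a] small by blast
    have cl: "E `` (?U - D1) \<inter> ?U \<subseteq> ?U - D1"
      using D1(1,2) symD[OF \<open>sym E\<close>] by blast
    have fD1: "finite D1" using D1(1) fU finite_subset by blast
    have "a \<le> card (?U - D1)"
      using \<open>3 * a \<le> card ?U\<close> D1 fD1 by (simp add: card_Diff_subset)
    then obtain D2 where D2: "D2 \<subseteq> ?U - D1" "E `` D2 \<inter> ?U \<subseteq> D2" "a \<le> card D2" "card D2 \<le> 2 * a"
      using obtain_closed_subset_of_size[of "?U - D1" E ?U a] cl fU \<open>sym E\<close> small by blast
    have "bd Z + bd Z \<le> bd D1 + bd D2"
      using least[of D1] least[of D2] D1 D2 by (intro add_mono) blast+
    \<comment> \<open>\<open>D1\<close> and \<open>D2\<close> are disjoint, so no edge into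
      \<open>Z\<close> is counted twice. Hence only one \<open>bd Z\<close> arises on the right,
      against two on the left.\<close>
    also have "\<dots> = card (E \<inter> D1 \<times> (W - D1) \<union> E \<inter> D2 \<times> (W - D2))"
      unfolding bd_def using D1(1) D2(1) W(1) fD1
      by (subst card_Un_disjoint) (auto intro: finite_subset[of _ "W \<times> W"])
    \<comment> \<open>Both sets are closed in \<open>?U\<close>, so an edge that leaves one of them
      within \<open>W\<close> ends in \<open>Z\<close> or in \<open>R\<close>.\<close>
    also have "\<dots> \<le> card (E \<inter> (W - Z) \<times> Z \<union> E \<inter> W \<times> R)"
    proof (rule card_mono)
      show "finite (E \<inter> (W - Z) \<times> Z \<union> E \<inter> W \<times> R)" using W(1) fZ fR by auto
      show "E \<inter> D1 \<times> (W - D1) \<union> E \<inter> D2 \<times> (W - D2) \<subseteq> E \<inter> (W - Z) \<times> Z \<union> E \<inter> W \<times> R"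
        using D1(1,2) D2(1,2) by blast
    qed
    also have "\<dots> \<le> card (E \<inter> (W - Z) \<times> Z) + card (E \<inter> W \<times> R)" by (rule card_Un_le)
    also have "card (E \<inter> (W - Z) \<times> Z) = bd Z"
      unfolding bd_def by (rule card_edges_swap[OF \<open>sym E\<close>])
    also have "card (E \<inter> W \<times> R) = card (E \<inter> R \<times> W)" by (rule card_edges_swap[OF \<open>sym E\<close>])
    also have "\<dots> \<le> d * card R"
      using deg R(1) W(2) fR by (intro card_edges_le) (auto simp: degrees_at_most_def)
    finally have bdZ: "bd Z \<le> d * card R" by linarith
    \<comment> \<open>Besides \<open>R\<close>, the vertices of \<open>Z\<close> with a neighbour in
      \<open>W - Z\<close> are removed. No edge between \<open>Z\<close> and \<open>W - Z\<close>
      survives, so every remaining component lies in \<open>Z\<close> or in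
      \<open>?U\<close>.\<close>
    define C where "C = R \<union> fst ` (E \<inter> Z \<times> (W - Z))"
    have "card C \<le> card R + card (fst ` (E \<inter> Z \<times> (W - Z)))" unfolding C_def by (rule card_Un_le)
    also have "card (fst ` (E \<inter> Z \<times> (W - Z))) \<le> bd Z"
      unfolding bd_def using fZ W(1) by (intro card_image_le) auto
    finally have "card C \<le> (d + 1) * card R" using bdZ by simp
    also have "\<dots> \<le> (d + 1) * (64 * s)" using R(2) by (rule mult_le_mono2)
    also have "\<dots> \<le> (d + 1) * (128 * s)" by (intro mult_le_mono2) simp
    also have "\<dots> = 128 * (d + 1) * s" by (simp only: mult_ac)
    finally have cC: "card C \<le> 128 * (d + 1) * s" .
    have CW: "C \<subseteq> W" using R(1) Z(1) by (auto simp: C_def)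
    have noedge: "y \<in> Z" if "x \<in> Z" "x \<in> W - C" "y \<in> W - C" "(x, y) \<in> E" for x y
      using that by (force simp: C_def)
    have "cut E W \<le> card C"
    proof (rule cut_le[OF W(1) Wne CW])
      fix v assume v: "v \<in> W - C"
      show "2 * card (component E (W - C) v) < card W"
      proof (cases "v \<in> Z")
        case True
        then have "component E (W - C) v \<subseteq> Z"
          using component_subset_closed[of v Z "W - C" E] noedge by blast
        then have "card (component E (W - C) v) \<le> card Z" using fZ by (rule card_mono[rotated])
        then show ?thesis using Z a by linarith
      next
        case False
        have "component E (W - C) v \<subseteq> component E ((W - C) \<inter> (- Z)) v \<inter> (- Z)"
          using False noedge symD[OF \<open>sym E\<close>] by (intro component_subset_closed) blast+
        also have "\<dots> \<subseteq> component E ?U v"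
          by (rule subset_trans[OF Int_lower1 component_mono]) (auto simp: C_def)
        finally have *: "component E (W - C) v \<subseteq> component E ?U v" .
        have vU: "v \<in> ?U" using v False by (auto simp: C_def)
        have "finite (component E ?U v)" using component_subset[OF vU, of E] fU finite_subset by blast
        then have "card (component E (W - C) v) \<le> a"
          using card_mono[OF _ *] small[OF vU] by linarith
        then show ?thesis using a by linarith
      qed
    qed
    then show ?thesis using cC by linarith
  qed
qed

section \<open>Iterating the enlargement\<close>

text \<open>A form of \<open>sep V E (real n) \<le> s\<close> that speaks of sets instead of
  suprema.\<close>

definition cuts_bounded :: "'a set \<Rightarrow> 'a rel \<Rightarrow> nat \<Rightarrow> nat \<Rightarrow> bool" where
  "cuts_bounded V E n s \<longleftrightarrow>
     (\<forall>W. W \<subseteq> V \<longrightarrow> finite W \<longrightarrow> W \<noteq> {} \<longrightarrow> card W \<le> n \<longrightarrow> cut E W \<le> s)"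

text \<open>The rounding loss is worst at \<open>n = 19\<close>. The bound serves both the
  requirement \<open>card W \<le> 32 * a\<close> and the count of enlargement steps.\<close>

lemma le_twenty_times_div_ten: "10 \<le> n \<Longrightarrow> n \<le> 20 * (n div 10)" for n :: nat
  by presburger

text \<open>A set \<open>W\<close> with more than \<open>n\<close> vertices is treated by
  \<open>cut_enlarge\<close> with \<open>a = card W div 10\<close>. The growth \<open>k\<close> is
  at most this \<open>a\<close>, so subsets smaller than \<open>W\<close> by \<open>a\<close> fall
  back into the known range.\<close>

lemma cuts_bounded_step:
  assumes "sym E" "degrees_at_most V E d" "10 \<le> n"
    and "cuts_bounded V E n s" "k \<le> n div 10"
  shows "cuts_bounded V E (n + k) (128 * (d + 1) * s)"
  unfolding cuts_bounded_def
proof (intro allI impI)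
  fix W assume W: "W \<subseteq> V" "finite W" "W \<noteq> {}" "card W \<le> n + k"
  show "cut E W \<le> 128 * (d + 1) * s"
  proof (cases "card W \<le> n")
    case True
    then have "cut E W \<le> s" using W assms(4) by (simp add: cuts_bounded_def)
    also have "s \<le> 128 * (d + 1) * s" by simp
    finally show ?thesis .
  next
    case False
    have "n div 10 \<le> card W div 10" using False by (intro div_le_mono) simp
    then have le: "card W \<le> n + card W div 10" using W(4) assms(5) by linarith
    show ?thesis
    proof (rule cut_enlarge[OF W(2,1) assms(1,2), of "card W div 10"])
      have "10 \<le> card W" using False assms(3) by linarith
      then show "0 < card W div 10" "10 * (card W div 10) \<le> card W" "card W \<le> 32 * (card W div 10)"
        using le_twenty_times_div_ten[of "card W"] by linarith+
      fix W' assume W': "W' \<subseteq> W" "W' \<noteq> {}" "card W' + card W div 10 \<le> card W"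
      then show "cut E W' \<le> s" using assms(4) W le finite_subset[of W' W]
        by (auto simp: cuts_bounded_def)
    qed
  qed
qed

text \<open>Steps of fixed width \<open>n div 10\<close>, which is at least a twentieth of
  \<open>n\<close>, reach \<open>K * n\<close> within \<open>20 * K\<close> rounds, so the factor
  does not depend on \<open>n\<close>. For \<open>n < 10\<close> this width is 0; there the trivial
  bound \<open>card W \<le> 10 * K\<close> suffices because \<open>1 \<le> s\<close>.\<close>

lemma cuts_bounded_scale:
  assumes "sym E" "degrees_at_most V E d" "cuts_bounded V E n s" "1 \<le> s"
  shows "cuts_bounded V E (K * n) ((10 * K + (128 * (d + 1)) ^ (20 * K)) * s)"
proof (cases "10 \<le> n")
  case True
  have iter: "cuts_bounded V E (n + i * (n div 10)) ((128 * (d + 1)) ^ i * s)" for i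
  proof (induction i)
    case 0
    then show ?case using assms(3) by simp
  next
    case (Suc i)
    have "cuts_bounded V E (n + i * (n div 10) + n div 10)
        (128 * (d + 1) * ((128 * (d + 1)) ^ i * s))"
      using True by (intro cuts_bounded_step[OF assms(1,2) _ Suc] div_le_mono) auto
    then show ?case by (simp add: algebra_simps)
  qed
  have "n \<le> 20 * (n div 10)" using True by (rule le_twenty_times_div_ten)
  then have "K * n \<le> K * (20 * (n div 10))" by (rule mult_le_mono2)
  then have "K * n \<le> n + 20 * K * (n div 10)" by (simp only: mult_ac trans_le_add2)
  moreover have "(128 * (d + 1)) ^ (20 * K) * s \<le> (10 * K + (128 * (d + 1)) ^ (20 * K)) * s"
    by (rule mult_le_mono1) simp
  ultimately show ?thesis using iter[of "20 * K"] unfolding cuts_bounded_def by (meson order_trans)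
next
  case False
  show ?thesis unfolding cuts_bounded_def
  proof (intro allI impI)
    fix W assume W: "W \<subseteq> V" "finite W" "W \<noteq> {}" "card W \<le> K * n"
    have "cut E W \<le> card W" using W by (simp add: cut_le_card)
    also have "\<dots> \<le> K * n" by (rule W(4))
    also have "\<dots> \<le> 10 * K" using False by simp
    also have "\<dots> \<le> 10 * K + (128 * (d + 1)) ^ (20 * K)" by simp
    also have "\<dots> \<le> (10 * K + (128 * (d + 1)) ^ (20 * K)) * s" using assms(4) by simp
    finally show "cut E W \<le> (10 * K + (128 * (d + 1)) ^ (20 * K)) * s" .
  qed
qed

section \<open>Pulling separators back\<close>

text \<open>Loops let a walk pause, so \<open>(E\<^sup>=) ^^ n\<close> relates the vertices joined
  by a walk of length at most \<open>n\<close>, and its images of points are closed balls.\<close>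

lemma relpow_reflcl_mono: "m \<le> n \<Longrightarrow> (E\<^sup>=) ^^ m \<subseteq> (E\<^sup>=) ^^ n"
proof (induction rule: dec_induct)
  case (step k)
  then show ?case by auto
qed simp

lemma relpow_subset_reflcl: "m \<le> n \<Longrightarrow> E ^^ m \<subseteq> (E\<^sup>=) ^^ n"
proof -
  have "E ^^ m \<subseteq> (E\<^sup>=) ^^ m" by (induction m) auto
  then show "E ^^ m \<subseteq> (E\<^sup>=) ^^ n" if "m \<le> n" using relpow_reflcl_mono[OF that, of E] by blast
qed

lemma sym_relpow: "sym E \<Longrightarrow> sym (E ^^ n)"
proof (induction n)
  case (Suc n)
  then have "(E ^^ Suc n)\<inverse> = E ^^ Suc n"
    by (simp add: converse_relcomp sym_conv_converse_eq flip: relpow_commute)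
  then show ?case by (simp add: sym_conv_converse_eq)
qed (simp add: sym_Id)

text \<open>Each vertex passes on itself and at most \<open>d\<close> neighbours to the next
  ball.\<close>

lemma ball_card_le:
  assumes "E \<subseteq> V \<times> V" "degrees_at_most V E d" "y \<in> V"
  shows "(E\<^sup>= ^^ r) `` {y} \<subseteq> V \<and> finite ((E\<^sup>= ^^ r) `` {y}) \<and> card ((E\<^sup>= ^^ r) `` {y}) \<le> (d + 1) ^ r"
proof (induction r)
  case 0
  then show ?case using assms by simp
next
  case (Suc r)
  let ?B = "(E\<^sup>= ^^ r) `` {y}"
  have eq: "(E\<^sup>= ^^ Suc r) `` {y} = (\<Union>z\<in>?B. insert z (E `` {z}))" by auto
  have z: "finite (E `` {z})" "card (insert z (E `` {z})) \<le> d + 1" if "z \<in> ?B" for z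
  proof -
    have *: "finite (E `` {z})" "card (E `` {z}) \<le> d"
      using that Suc assms(2) by (auto simp: degrees_at_most_def)
    then show "finite (E `` {z})" "card (insert z (E `` {z})) \<le> d + 1"
      by (auto simp: card_insert_if)
  qed
  have "card (\<Union>z\<in>?B. insert z (E `` {z})) \<le> (\<Sum>z\<in>?B. card (insert z (E `` {z})))"
    using Suc by (intro card_UN_le) auto
  also have "\<dots> \<le> card ?B * (d + 1)" 
    using sum_bounded_above[of ?B "\<lambda>z. card (insert z (E `` {z}))" "d + 1"] z(2) by simp
  also have "\<dots> \<le> (d + 1) ^ r * (d + 1)" using Suc by (intro mult_le_mono1) auto
  finally have "card (\<Union>z\<in>?B. insert z (E `` {z})) \<le> (d + 1) ^ Suc r" by (simp add: mult.commute)
  moreover have "finite (\<Union>z\<in>?B. insert z (E `` {z}))" using Suc z(1) by blast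
  moreover have "(\<Union>z\<in>?B. insert z (E `` {z})) \<subseteq> V" using Suc assms(1) by blast
  ultimately show ?case unfolding eq by blast
qed

text \<open>Every vertex of the walk is within distance \<open>r\<close> of \<open>y\<close>, so the
  walk stays in \<open>W\<close>.\<close>

lemma relpow_imp_component:
  assumes "(y, z) \<in> E ^^ n" "n \<le> r" "(E\<^sup>= ^^ r) `` {y} \<subseteq> W"
  shows "z \<in> component E W y"
  using assms(1,2)
proof (induction n arbitrary: z)
  case (Suc n)
  then obtain w where w: "(y, w) \<in> E ^^ n" "(w, z) \<in> E" by auto
  have "w \<in> W" "z \<in> W"
    using relpow_subset_reflcl[of n r E] relpow_subset_reflcl[of "Suc n" r E] w(1) Suc.prems assms(3)
    by auto
  then show ?case using Suc.IH[OF w(1)] Suc.prems(2) w(2) by (auto intro: component_step)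
qed simp

text \<open>The \<open>r\<close>-balls around the images of \<open>S\<close> form a set
  \<open>S'\<close> of at most \<open>p * card S\<close> vertices, which is broken into pieces by a
  set \<open>R\<close>. Adjacent vertices outside the pulled-back separator have images in the same
  piece, so a component of \<open>S - C\<close> has at most \<open>k\<close> times as many vertices
  as one piece.\<close>

lemma cut_pullback:
  assumes "E\<^sub>Y \<subseteq> V\<^sub>Y \<times> V\<^sub>Y" "sym E\<^sub>Y" and deg: "degrees_at_most V\<^sub>Y E\<^sub>Y d"
    and f: "f \<in> V\<^sub>X \<rightarrow> V\<^sub>Y"
    and lip: "\<And>u v. u \<in> V\<^sub>X \<Longrightarrow> v \<in> V\<^sub>X \<Longrightarrow> (u, v) \<in> E\<^sub>X \<Longrightarrow> \<exists>n\<le>r. (f u, f v) \<in> E\<^sub>Y ^^ n"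
    and fib: "\<And>y. y \<in> V\<^sub>Y \<Longrightarrow> finite {x \<in> V\<^sub>X. f x = y} \<and> card {x \<in> V\<^sub>X. f x = y} \<le> k"
    and S: "S \<subseteq> V\<^sub>X" "finite S" "S \<noteq> {}" "card S \<le> n"
    and bdd: "cuts_bounded V\<^sub>Y E\<^sub>Y ((d + 1) ^ r * n) s"
  shows "cut E\<^sub>X S \<le> (d + 1) ^ r * k * 2 ^ Suc (2 * (d + 1) ^ r * k) * s"
proof -
  define p where "p = (d + 1) ^ r"
  \<comment> \<open>It suffices that \<open>2 ^ j\<close> exceeds \<open>2 * p * k\<close>; this
    choice works because \<open>j < 2 ^ j\<close>.\<close>
  define j where "j = 2 * p * k"
  define ball where "ball y = (E\<^sub>Y\<^sup>= ^^ r) `` {y}" for y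
  have ball: "ball y \<subseteq> V\<^sub>Y" "finite (ball y)" "card (ball y) \<le> p" if "y \<in> V\<^sub>Y" for y
    using ball_card_le[OF assms(1) deg that] by (auto simp: ball_def p_def)
  have ball_sym: "y \<in> ball z" if "z \<in> ball y" for y z
  proof -
    have "sym (E\<^sub>Y\<^sup>=)" using assms(2) by (auto simp: sym_def)
    then show ?thesis using that sym_relpow[of "E\<^sub>Y\<^sup>=" r] by (auto simp: ball_def dest: symD)
  qed
  have ball_self: "y \<in> ball y" for y using relpow_subset_reflcl[of 0 r E\<^sub>Y] by (auto simp: ball_def)
  have fS: "f u \<in> V\<^sub>Y" if "u \<in> S" for u using that S(1) f by auto
  define S' where "S' = (\<Union>u\<in>S. ball (f u))"
  have S': "S' \<subseteq> V\<^sub>Y" "finite S'" using ball fS S(2) by (auto simp: S'_def)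
  have "card S' \<le> (\<Sum>u\<in>S. card (ball (f u)))" unfolding S'_def using S(2) by (rule card_UN_le)
  also have "\<dots> \<le> card S * p" using ball(3) fS by (metis sum_bounded_above of_nat_id)
  finally have cS': "card S' \<le> p * card S" by (simp add: mult.commute)
  also have "\<dots> \<le> p * n" using S(4) by (rule mult_le_mono2)
  finally have cS'n: "card S' \<le> p * n" .
  have "\<exists>R\<subseteq>S'. card R \<le> 2 ^ Suc j * s \<and>
    (\<forall>v\<in>S' - R. card (component E\<^sub>Y (S' - R) v) * 2 ^ j \<le> card S')"
  proof (rule fragment[OF S'(2) assms(2)])
    fix W' assume W': "W' \<subseteq> S'" "W' \<noteq> {}"
    then have "card W' \<le> p * n" using cS'n card_mono[OF S'(2)] by (meson order_trans)
    then show "cut E\<^sub>Y W' \<le> s" using W' S' bdd finite_subset[of W' S']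
      by (auto simp: cuts_bounded_def p_def)
  qed
  then obtain R where R: "R \<subseteq> S'" "card R \<le> 2 ^ Suc j * s"
    and frag: "\<And>v. v \<in> S' - R \<Longrightarrow> card (component E\<^sub>Y (S' - R) v) * 2 ^ j \<le> card S'"
    by blast
  have fR: "finite R" using R(1) S'(2) finite_subset by blast
  define fibre where "fibre y = {x \<in> V\<^sub>X. f x = y}" for y
  have fibre_card: "card (\<Union>y\<in>Y. fibre y) \<le> k * card Y" "finite (\<Union>y\<in>Y. fibre y)"
    if "finite Y" "Y \<subseteq> V\<^sub>Y" for Y
  proof -
    show "finite (\<Union>y\<in>Y. fibre y)" using fib that by (auto simp: fibre_def)
    have "card (\<Union>y\<in>Y. fibre y) \<le> (\<Sum>y\<in>Y. card (fibre y))" using that(1) by (rule card_UN_le)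
    also have "\<dots> \<le> card Y * k"
      using sum_bounded_above[of Y "\<lambda>y. card (fibre y)" k] fib that(2) by (auto simp: fibre_def)
    finally show "card (\<Union>y\<in>Y. fibre y) \<le> k * card Y" by (simp add: mult.commute)
  qed
  \<comment> \<open>Removing each \<open>u\<close> whose whole ball meets \<open>R\<close>, and not
    only those with \<open>f u \<in> R\<close>, keeps the walks between images of adjacent vertices
    clear of \<open>R\<close>.\<close>
  define C where "C = {u \<in> S. ball (f u) \<inter> R \<noteq> {}}"
  have N: "finite (\<Union>y\<in>R. ball y)" "(\<Union>y\<in>R. ball y) \<subseteq> V\<^sub>Y"
    using fR R(1) S'(1) ball by blast+
  \<comment> \<open>By symmetry of balls, \<open>f u\<close> lies in a ball around a vertex of
    \<open>R\<close> whenever \<open>u \<in> C\<close>.\<close>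
  have "C \<subseteq> (\<Union>y\<in>(\<Union>z\<in>R. ball z). fibre y)"
    using ball_sym S(1) by (fastforce simp: C_def fibre_def)
  then have "card C \<le> card (\<Union>y\<in>(\<Union>z\<in>R. ball z). fibre y)"
    using fibre_card(2)[OF N] by (rule card_mono[rotated])
  also have "\<dots> \<le> k * card (\<Union>z\<in>R. ball z)" by (rule fibre_card(1)[OF N])
  also have "card (\<Union>z\<in>R. ball z) \<le> (\<Sum>z\<in>R. card (ball z))" using fR by (rule card_UN_le)
  also have "\<dots> \<le> card R * p"
    using sum_bounded_above[of R "\<lambda>z. card (ball z)" p] ball(3) R(1) S'(1) by auto
  also have "\<dots> \<le> 2 ^ Suc j * s * p" using R(2) by (rule mult_le_mono1)
  finally have cC: "card C \<le> p * k * 2 ^ Suc j * s" by (simp add: mult_ac)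
  have "cut E\<^sub>X S \<le> card C"
  proof (rule cut_le[OF S(2,3)])
    show "C \<subseteq> S" by (auto simp: C_def)
    fix u assume u: "u \<in> S - C"
    let ?K = "component E\<^sub>Y (S' - R) (f u)"
    have inball: "ball (f v) \<subseteq> S' - R" if "v \<in> S - C" for v
      using that by (auto simp: C_def S'_def)
    have fu: "f u \<in> S' - R" using inball[OF u] ball_self by blast
    have K: "?K \<subseteq> S' - R" by (rule component_subset[OF fu])
    have fK: "finite ?K" using K S'(2) finite_subset by blast
    have "component E\<^sub>X (S - C) u \<subseteq> component E\<^sub>X ((S - C) \<inter> {v. f v \<in> ?K}) u \<inter> {v. f v \<in> ?K}"
    proof (rule component_subset_closed)
      fix x y assume xy: "x \<in> {v. f v \<in> ?K}" "x \<in> S - C" "y \<in> S - C" "(x, y) \<in> E\<^sub>X"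
      then obtain m where m: "m \<le> r" "(f x, f y) \<in> E\<^sub>Y ^^ m" using lip[of x y] S(1) by blast
      then have "f y \<in> component E\<^sub>Y (S' - R) (f x)"
        using relpow_imp_component inball[OF xy(2)] unfolding ball_def by metis
      then show "y \<in> {v. f v \<in> ?K}" using component_eq[OF assms(2), of "f x"] xy(1) by auto
    qed simp
    then have "component E\<^sub>X (S - C) u \<subseteq> (\<Union>y\<in>?K. fibre y)"
      using component_subset[OF u, of E\<^sub>X] S(1) unfolding fibre_def by blast
    moreover have K': "?K \<subseteq> V\<^sub>Y" using K S'(1) by blast
    ultimately have le: "card (component E\<^sub>X (S - C) u) \<le> k * card ?K"
      using card_mono fibre_card[OF fK K'] by (meson order_trans)
    show "2 * card (component E\<^sub>X (S - C) u) < card S"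
    proof (rule ccontr)
      assume "\<not> ?thesis"
      then have cS: "card S \<le> 2 * (k * card ?K)" using le by linarith
      \<comment> \<open>Cancelling \<open>card ?K\<close> in the chain that follows would leave
        \<open>2 ^ j \<le> j\<close>.\<close>
      have "card ?K * 2 ^ j \<le> p * card S" using frag[OF fu] cS' by linarith
      also have "\<dots> \<le> p * (2 * (k * card ?K))" using cS by (rule mult_le_mono2)
      also have "\<dots> = card ?K * j" by (simp add: j_def)
      finally have "card ?K * 2 ^ j \<le> card ?K * j" .
      moreover have "card ?K > 0" using fK component_self[of "f u" E\<^sub>Y "S' - R"]
        by (metis card_gt_0_iff empty_iff)
      ultimately show False using less_exp[of j] by auto
    qed
  qed
  then show ?thesis using cC by (simp add: p_def j_def)
qed

section \<open>The separation function\<close>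

text \<open>The supremum of natural numbers is meaningful only for a bounded set; here
  \<open>cut E S \<le> card S\<close> bounds the values by the integer part of
  \<open>x\<close>.\<close>

lemma cut_le_sep:
  assumes "S \<subseteq> V" "finite S" "S \<noteq> {}" "real (card S) \<le> x"
  shows "cut E S \<le> sep V E x"
  unfolding sep_def
proof (rule cSup_upper)
  show "bdd_above {cut E S |S. S \<subseteq> V \<and> finite S \<and> S \<noteq> {} \<and> real (card S) \<le> x}"
  proof (rule bdd_aboveI)
    fix m assume "m \<in> {cut E S |S. S \<subseteq> V \<and> finite S \<and> S \<noteq> {} \<and> real (card S) \<le> x}"
    then obtain S where "m = cut E S" "finite S" "S \<noteq> {}" "real (card S) \<le> x" by blast
    then show "m \<le> nat \<lfloor>x\<rfloor>" using cut_le_card[of S E] by (simp add: le_nat_floor)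
  qed
qed (use assms in blast)

lemma sep_leI:
  assumes "\<And>S. S \<subseteq> V \<Longrightarrow> finite S \<Longrightarrow> S \<noteq> {} \<Longrightarrow> real (card S) \<le> x \<Longrightarrow> cut E S \<le> m"
  shows "sep V E x \<le> m"
proof (cases "{cut E S |S. S \<subseteq> V \<and> finite S \<and> S \<noteq> {} \<and> real (card S) \<le> x} = {}")
  case True
  then show ?thesis by (simp only: sep_def Sup_nat_empty)
next
  case False
  then show ?thesis unfolding sep_def using assms by (intro cSup_least) auto
qed

section \<open>Regular maps between graphs\<close>

text \<open>Graph distances are integers, so open balls of radius 1 are single vertices and the
  centres \<open>T\<close> of a cover already contain the fibre.\<close>

lemma regular_map_fibre:
  assumes "connected_graph V\<^sub>X E\<^sub>X" "connected_graph V\<^sub>Y E\<^sub>Y"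
    and "regular_map \<kappa> V\<^sub>X (graph_dist E\<^sub>X) V\<^sub>Y (graph_dist E\<^sub>Y) f" and y: "y \<in> V\<^sub>Y"
  shows "finite {x \<in> V\<^sub>X. f x = y} \<and> card {x \<in> V\<^sub>X. f x = y} \<le> nat \<lfloor>\<kappa>\<rfloor>"
proof -
  interpret X: Metric_space V\<^sub>X "graph_dist E\<^sub>X" by (rule Metric_space_graph_dist[OF assms(1)])
  interpret Y: Metric_space V\<^sub>Y "graph_dist E\<^sub>Y" by (rule Metric_space_graph_dist[OF assms(2)])
  obtain T where T: "T \<subseteq> V\<^sub>X" "finite T" "real (card T) \<le> \<kappa>"
    "{x \<in> V\<^sub>X. f x \<in> Y.mball y 1} \<subseteq> (\<Union>t\<in>T. X.mball t 1)"
    using assms(3) y unfolding regular_map_def by meson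
  have "{x \<in> V\<^sub>X. f x = y} \<subseteq> T"
  proof safe
    fix x assume x: "x \<in> V\<^sub>X" "y = f x"
    then have "f x \<in> Y.mball y 1" using y by simp
    then obtain t where t: "t \<in> T" "x \<in> X.mball t 1" using T(4) x by blast
    then have "graph_dist E\<^sub>X t x < 1" by simp
    then have "graph_dist E\<^sub>X t x = 0" by (simp add: graph_dist_def)
    then show "x \<in> T" using t T(1) x X.zero by blast
  qed
  then have "finite {x \<in> V\<^sub>X. f x = y} \<and> card {x \<in> V\<^sub>X. f x = y} \<le> card T"
    using T(2) by (meson card_mono finite_subset)
  moreover have "card T \<le> nat \<lfloor>\<kappa>\<rfloor>" using T(3) by (rule le_nat_floor)
  ultimately show ?thesis by linarith
qed

text \<open>Adjacent vertices are at distance at most 1, so their images are at distance at most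
  \<open>2 * \<kappa>\<close>, which may be rounded down because distances are integers.\<close>

lemma regular_map_edge:
  assumes "connected_graph V\<^sub>Y E\<^sub>Y" "regular_map \<kappa> V\<^sub>X (graph_dist E\<^sub>X) V\<^sub>Y (graph_dist E\<^sub>Y) f"
    and "0 \<le> \<kappa>" and uv: "u \<in> V\<^sub>X" "v \<in> V\<^sub>X" "(u, v) \<in> E\<^sub>X"
  shows "\<exists>n \<le> nat \<lfloor>2 * \<kappa>\<rfloor>. (f u, f v) \<in> E\<^sub>Y ^^ n"
proof -
  have f: "f u \<in> V\<^sub>Y" "f v \<in> V\<^sub>Y" using assms(2) uv by (auto simp: regular_map_def)
  have "(u, v) \<in> E\<^sub>X ^^ 1" using uv by simp
  then have "(LEAST n. (u, v) \<in> E\<^sub>X ^^ n) \<le> 1" by (rule Least_le)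
  then have d1: "graph_dist E\<^sub>X u v \<le> 1" by (simp add: graph_dist_def)
  have "graph_dist E\<^sub>Y (f u) (f v) \<le> \<kappa> * (1 + graph_dist E\<^sub>X u v)"
    using assms(2) uv by (auto simp: regular_map_def)
  also have "\<dots> \<le> \<kappa> * (1 + 1)" using d1 assms(3) by (intro mult_left_mono) auto
  finally have "(LEAST n. (f u, f v) \<in> E\<^sub>Y ^^ n) \<le> nat \<lfloor>2 * \<kappa>\<rfloor>"
    by (intro le_nat_floor) (simp add: graph_dist_def)
  moreover have "\<exists>n. (f u, f v) \<in> E\<^sub>Y ^^ n"
    using assms(1) f by (auto simp: connected_graph_def dest: rtrancl_imp_relpow)
  then have "(f u, f v) \<in> E\<^sub>Y ^^ (LEAST n. (f u, f v) \<in> E\<^sub>Y ^^ n)" by (rule LeastI_ex)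
  ultimately show ?thesis by blast
qed

theorem lemma1p3:
  fixes V\<^sub>X :: "'a set" and E\<^sub>X :: "'a rel" and V\<^sub>Y :: "'b set" and E\<^sub>Y :: "'b rel"
    and d :: nat and \<kappa> :: real and f :: "'a \<Rightarrow> 'b"
  assumes "connected_graph V\<^sub>X E\<^sub>X" and "connected_graph V\<^sub>Y E\<^sub>Y"
    and "degrees_at_most V\<^sub>X E\<^sub>X d" and "degrees_at_most V\<^sub>Y E\<^sub>Y d"
    and "regular_map \<kappa> V\<^sub>X (graph_dist E\<^sub>X) V\<^sub>Y (graph_dist E\<^sub>Y) f"
  shows "\<exists>C::real. \<forall>x::real. real (sep V\<^sub>X E\<^sub>X x) \<le> C * real (sep V\<^sub>Y E\<^sub>Y x)"
proof -
  define k where "k = nat \<lfloor>\<kappa>\<rfloor>"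
  define r where "r = nat \<lfloor>2 * \<kappa>\<rfloor>"
  define p where "p = (d + 1) ^ r"
  \<comment> \<open>The pull-back needs separators in the target at scale \<open>p\<close> times
    \<open>x\<close>; \<open>A\<close> is the factor paid for returning to scale
    \<open>x\<close>.\<close>
  define A where "A = 10 * p + (128 * (d + 1)) ^ (20 * p)"
  define C where "C = p * k * 2 ^ Suc (2 * p * k) * A"
  have EY: "E\<^sub>Y \<subseteq> V\<^sub>Y \<times> V\<^sub>Y" "sym E\<^sub>Y"
    using assms(2) by (auto simp: connected_graph_def simple_graph_def)
  have f: "f \<in> V\<^sub>X \<rightarrow> V\<^sub>Y" using assms(5) by (simp add: regular_map_def)
  have "sep V\<^sub>X E\<^sub>X x \<le> C * sep V\<^sub>Y E\<^sub>Y x" for x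
  \<comment> \<open>Only nonempty sets \<open>S\<close> are considered, which yields
    \<open>1 \<le> x\<close> and a vertex in the target graph.\<close>
  proof (rule sep_leI)
    fix S assume S: "S \<subseteq> V\<^sub>X" "finite S" "S \<noteq> {}" "real (card S) \<le> x"
    then obtain u where u: "u \<in> V\<^sub>X" by blast
    then have y: "f u \<in> V\<^sub>Y" using f by auto
    have "1 \<le> card S" using S by (simp add: Suc_leI card_gt_0_iff)
    then have x: "1 \<le> x" using S(4) by linarith
    have "0 \<le> \<kappa>"
    proof -
      obtain T :: "'a set" where "real (card T) \<le> \<kappa>"
        using assms(5) y unfolding regular_map_def by meson
      then show ?thesis using of_nat_0_le_iff[of "card T"] by linarith
    qed
    \<comment> \<open>A one-vertex set makes the target's separation function at least 1, as
      \<open>cuts_bounded_scale\<close> requires.\<close>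
    have "1 \<le> cut E\<^sub>Y {f u}" by (rule cut_pos) auto
    also have "\<dots> \<le> sep V\<^sub>Y E\<^sub>Y x" using y x by (intro cut_le_sep) auto
    finally have s: "1 \<le> sep V\<^sub>Y E\<^sub>Y x" .
    have "cuts_bounded V\<^sub>Y E\<^sub>Y (nat \<lfloor>x\<rfloor>) (sep V\<^sub>Y E\<^sub>Y x)"
      unfolding cuts_bounded_def using x by (auto intro!: cut_le_sep simp: le_nat_iff le_floor_iff)
    then have "cuts_bounded V\<^sub>Y E\<^sub>Y (p * nat \<lfloor>x\<rfloor>) (A * sep V\<^sub>Y E\<^sub>Y x)"
      unfolding A_def by (rule cuts_bounded_scale[OF EY(2) assms(4) _ s])
    then have "cut E\<^sub>X S \<le> p * k * 2 ^ Suc (2 * p * k) * (A * sep V\<^sub>Y E\<^sub>Y x)"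
      unfolding p_def k_def r_def
      using regular_map_edge[OF assms(2,5) \<open>0 \<le> \<kappa>\<close>] regular_map_fibre[OF assms(1,2,5)] S
      by (intro cut_pullback[OF EY assms(4) f]) (auto intro: le_nat_floor)
    then show "cut E\<^sub>X S \<le> C * sep V\<^sub>Y E\<^sub>Y x" by (simp add: C_def mult_ac)
  qed
  then have "real (sep V\<^sub>X E\<^sub>X x) \<le> real C * real (sep V\<^sub>Y E\<^sub>Y x)" for x
    by (metis of_nat_le_iff of_nat_mult)
  then show ?thesis by blast
qed

end
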